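(* Let $\boldsymbol u^{\mathrm{low}},\boldsymbol u^{\mathrm{upp}}\in\mathbb R^{N_1\times N_2\times K}$ with $\boldsymbol u^{\mathrm{low}}\le\boldsymbol u^{\mathrm{upp}}$ entrywise, let $\boldsymbol A=\tilde{\boldsymbol\nabla}_{\boldsymbol x,t}\tilde{\boldsymbol\Delta}:\mathbb R^{N_1\times N_2\times K}\to\mathbb R^{N_1\times N_2\times K\times 3}$ be the linear operator defined in the context, let $$S:=\{\boldsymbol v\in\mathbb R^{N_1\times N_2\times K\times 3} : \|\boldsymbol v_{i,j,k}\|\le 1\text{ for all } i,j,k\},$$ and let $\mu>0$. Consider the problem $\max_{\boldsymbol v\in S}\min_{\boldsymbol w\in[\boldsymbol u^{\mathrm{low}},\boldsymbol u^{\mathrm{upp}}]}\langle\boldsymbol A^\top\boldsymbol v,\boldsymbol w\rangle$, written equivalently as $$\min_{\boldsymbol v\in S}\ \max_{\boldsymbol w\in[\boldsymbol u^{\mathrm{low}},\boldsymbol u^{\mathrm{upp}}]}\ \langle-\boldsymbol A^\top\boldsymbol v,\boldsymbol w\rangle .$$ Then, up to the positive constant factor $\frac{\mu}{2}$ in the objective, its Nesterov smoothing with parameter $\mu$ is the problem $$\min_{\boldsymbol v\in S}\ \Big\{\Big\|\tfrac1\mu\boldsymbol A^\top\boldsymbol v\Big\|^2-\Big\|(I-P_{[\boldsymbol u^{\mathrm{low}},\boldsymbol u^{\mathrm{upp}}]})\big(-\tfrac1\mu\boldsymbol A^\top\boldsymbol v\big)\Big\|^2\Big\}.$$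
   Context: Notation: $\|\cdot\|$ is the Euclidean norm and $\langle\cdot,\cdot\rangle$ the Euclidean (entrywise) inner product; for $\boldsymbol v\in\mathbb R^{N_1\times N_2\times K\times 3}$, $\boldsymbol v_{i,j,k}\in\mathbb R^3$. $[\boldsymbol u^{\mathrm{low}},\boldsymbol u^{\mathrm{upp}}]$ is the set of arrays $\boldsymbol u$ with $u^{\mathrm{low}}_{i,j,k}\le u_{i,j,k}\le u^{\mathrm{upp}}_{i,j,k}$ for all $(i,j,k)$. $P_C$ is the Euclidean projection onto a nonempty closed convex set $C$, and $I$ is the identity. $\boldsymbol A^\top$ is the adjoint of $\boldsymbol A$ with respect to the Euclidean inner products. Nesterov smoothing: for a problem $\min_{\boldsymbol u\in C_1}\phi(\boldsymbol u)$ with $\phi(\boldsymbol u)=\max_{\boldsymbol w\in C_2}\langle\boldsymbol B\boldsymbol u,\boldsymbol w\rangle$, where $\boldsymbol B$ is linear and $C_1,C_2$ are bounded closed convex sets, its Nesterov smoothing with parameter $\mu>0$ is the problem $\min_{\boldsymbol u\in C_1}\phi_\mu(\boldsymbol u)$ with $$\phi_\mu(\boldsymbol u):=\max_{\boldsymbol w\in C_2}\Big\{\langle\boldsymbol B\boldsymbol u,\boldsymbol w\rangle-\frac\mu2\|\boldsymbol w\|^2\Big\}.$$ Here it is applied with $C_1=S$, $C_2=[\boldsymbol u^{\mathrm{low}},\boldsymbol u^{\mathrm{upp}}]$, $\boldsymbol B=-\boldsymbol A^\top$. Definition of $\boldsymbol A$: $N_1,N_2\ge 2$, $K\ge1$ are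 integers, $h_1,h_2>0$ grid sizes, $0<t_1<\dots<t_K$ with $t_{k+1}=bt_k$ for a fixed $b>1$. The discrete scale-normalized Laplacian $\tilde{\boldsymbol\Delta}:\mathbb R^{N_1\times N_2\times K}\to\mathbb R^{N_1\times N_2\times K}$ is $$(\tilde{\boldsymbol\Delta}\boldsymbol u)_{i,j,k}=t_k\Big(\tfrac{u_{i+1,j,k}-2u_{i,j,k}+u_{i-1,j,k}}{h_1^2}+\tfrac{u_{i,j+1,k}-2u_{i,j,k}+u_{i,j-1,k}}{h_2^2}\Big),$$ with the conventions $u_{0,j,k}:=u_{2,j,k}$, $u_{N_1+1,j,k}:=u_{N_1-1,j,k}$, $u_{i,0,k}:=u_{i,2,k}$, $u_{i,N_2+1,k}:=u_{i,N_2-1,k}$. The discrete scale-space gradient $\tilde{\boldsymbol\nabla}_{\boldsymbol x,t}:\mathbb R^{N_1\times N_2\times K}\to\mathbb R^{N_1\times N_2\times K\times 3}$ has as $(i,j,k)$ component the vector in $\mathbb R^3$ with entries $$t_k^{1/2}\tfrac{u_{i+1,j,k}-u_{i,j,k}}{h_1},\qquad t_k^{1/2}\tfrac{u_{i,j+1,k}-u_{i,j,k}}{h_2},\qquad \tfrac{1}{b-1}(u_{i,j,k+1}-u_{i,j,k}),$$ with the conventions (for this operator) $u_{N_1+1,j,k}:=u_{N_1,j,k}$, $u_{i,N_2+1,k}:=u_{i,N_2,k}$, $u_{i,j,K+1}:=u_{i,j,K}$. *)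

theory Defs
  imports "HOL-Analysis.Analysis"
begin

text \<open>
  \<open>('a, 'n1, 'n2, 'k) grid\<close> is \<open>'a ^ 'k ^ 'n2 ^ 'n1\<close>. An array in \<open>\<real>\<^bsup>N1\<times>N2\<times>K\<^esup>\<close> is such a grid of
  reals, and one in \<open>\<real>\<^bsup>N1\<times>N2\<times>K\<times>3\<^esup>\<close> a grid of vectors in \<open>real ^ 3\<close>, over finite, linearly ordered index types with \<open>CARD('n1) = N1\<close>, \<open>CARD('n2) = N2\<close> and \<open>CARD('k) = K\<close>; its
  library norm, inner product and order are the Euclidean and entrywise ones.
  \<open>index_of\<close> numbers the elements of such an index type increasingly by \<open>1, \<dots>, N\<close>.
\<close>

type_synonym ('a, 'n1, 'n2, 'k) grid = "((('a, 'k) vec, 'n2) vec, 'n1) vec"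

definition index_of :: "'n::{finite,linorder} \<Rightarrow> nat" where
  "index_of x = card {..x}"

lemma strict_mono_index_of: "strict_mono (index_of :: 'n::{finite,linorder} \<Rightarrow> nat)"
  by (auto simp: strict_mono_def index_of_def intro!: psubset_card_mono)

lemma bij_betw_index_of:
  "bij_betw (index_of :: 'n::{finite,linorder} \<Rightarrow> nat) UNIV {1..CARD('n)}"
proof -
  have inj: "inj (index_of :: 'n \<Rightarrow> nat)"
    using strict_mono_index_of strict_mono_imp_inj_on by blast
  have "index_of x \<in> {1..CARD('n)}" for x :: 'n
    using card_mono[of UNIV "{..x}"] by (auto simp: index_of_def Suc_le_eq card_gt_0_iff)
  then have "range (index_of :: 'n \<Rightarrow> nat) \<subseteq> {1..CARD('n)}"
    by blast
  moreover have "card (range (index_of :: 'n \<Rightarrow> nat)) = card {1..CARD('n)}"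
    using inj by (simp add: card_image)
  ultimately have "range (index_of :: 'n \<Rightarrow> nat) = {1..CARD('n)}"
    by (intro card_subset_eq) auto
  then show ?thesis
    using inj by (simp add: bij_betw_def)
qed

definition entry :: "(real, 'n1::{finite,linorder}, 'n2::{finite,linorder}, 'k::{finite,linorder}) grid
    \<Rightarrow> nat \<Rightarrow> nat \<Rightarrow> nat \<Rightarrow> real" where
  "entry u i j k = u $ (inv index_of i) $ (inv index_of j) $ (inv index_of k)"

lemma entry_index_of: "entry u (index_of p) (index_of q) (index_of r) = u $ p $ q $ r"
  by (simp add: entry_def inv_f_f strict_mono_imp_inj_on strict_mono_index_of)

text \<open>Out-of-range positions: \<open>0 \<mapsto> 2\<close>, \<open>N + 1 \<mapsto> N - 1\<close> for the Laplacian, and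
  \<open>N + 1 \<mapsto> N\<close> for the gradient.\<close>

definition reflect :: "nat \<Rightarrow> nat \<Rightarrow> nat" where
  "reflect N i = (if i = 0 then 2 else if i = N + 1 then N - 1 else i)"

definition replicate_end :: "nat \<Rightarrow> nat \<Rightarrow> nat" where
  "replicate_end N i = (if i = N + 1 then N else i)"

definition scaled_laplacian :: "(nat \<Rightarrow> real) \<Rightarrow> real \<Rightarrow> real
    \<Rightarrow> (real, 'n1::{finite,linorder}, 'n2::{finite,linorder}, 'k::{finite,linorder}) grid
    \<Rightarrow> (real, 'n1, 'n2, 'k) grid" where
  "scaled_laplacian t h1 h2 u = (\<chi> p. \<chi> q. \<chi> r.
     let i = index_of p; j = index_of q; k = index_of r;
         e = (\<lambda>i j. entry u (reflect CARD('n1) i) (reflect CARD('n2) j) k)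
     in t k * ((e (i + 1) j - 2 * e i j + e (i - 1) j) / h1\<^sup>2
             + (e i (j + 1) - 2 * e i j + e i (j - 1)) / h2\<^sup>2))"

definition scale_space_gradient :: "(nat \<Rightarrow> real) \<Rightarrow> real \<Rightarrow> real \<Rightarrow> real
    \<Rightarrow> (real, 'n1::{finite,linorder}, 'n2::{finite,linorder}, 'k::{finite,linorder}) grid
    \<Rightarrow> (real ^ 3, 'n1, 'n2, 'k) grid" where
  "scale_space_gradient t b h1 h2 u = (\<chi> p. \<chi> q. \<chi> r.
     let i = index_of p; j = index_of q; k = index_of r;
         e = (\<lambda>i j k. entry u (replicate_end CARD('n1) i) (replicate_end CARD('n2) j)
                              (replicate_end CARD('k) k))
     in vector [sqrt (t k) * ((e (i + 1) j k - e i j k) / h1),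
                sqrt (t k) * ((e i (j + 1) k - e i j k) / h2),
                1 / (b - 1) * (e i j (k + 1) - e i j k)])"

definition grad_laplacian :: "(nat \<Rightarrow> real) \<Rightarrow> real \<Rightarrow> real \<Rightarrow> real
    \<Rightarrow> (real, 'n1::{finite,linorder}, 'n2::{finite,linorder}, 'k::{finite,linorder}) grid
    \<Rightarrow> (real ^ 3, 'n1, 'n2, 'k) grid" where
  "grad_laplacian t b h1 h2 = scale_space_gradient t b h1 h2 \<circ> scaled_laplacian t h1 h2"

lemma linear_scaled_laplacian: "linear (scaled_laplacian t h1 h2)"
  by (rule linearI)
    (auto simp: vec_eq_iff scaled_laplacian_def entry_def Let_def add_divide_distrib
      diff_divide_distrib algebra_simps)

lemma linear_scale_space_gradient: "linear (scale_space_gradient t b h1 h2)"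
  by (rule linearI)
    (auto simp: vec_eq_iff scale_space_gradient_def entry_def Let_def add_divide_distrib
      diff_divide_distrib algebra_simps forall_3)

text \<open>In particular the library's \<open>adjoint\<close> of this operator is its genuine adjoint.\<close>

lemma linear_grad_laplacian: "linear (grad_laplacian t b h1 h2)"
  unfolding grad_laplacian_def
  by (rule linear_compose[OF linear_scaled_laplacian linear_scale_space_gradient])

definition pointwise_unit_balls :: "(real ^ 3, 'n1::finite, 'n2::finite, 'k::finite) grid set" where
  "pointwise_unit_balls = {v. \<forall>i j k. norm (v $ i $ j $ k) \<le> 1}"

text \<open>Maximum and minimum, as opposed to supremum and infimum: the values are determined only
  if they are attained, as in the lemma below.\<close>

definition max_over :: "'a set \<Rightarrow> ('a \<Rightarrow> real) \<Rightarrow> real" where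
  "max_over C f = (GREATEST y. y \<in> f ` C)"

definition min_over :: "'a set \<Rightarrow> ('a \<Rightarrow> real) \<Rightarrow> real" where
  "min_over C f = (LEAST y. y \<in> f ` C)"

lemma max_over_attained:
  fixes f :: "'a::topological_space \<Rightarrow> real"
  assumes "compact C" "C \<noteq> {}" "continuous_on C f"
  shows "\<exists>w\<in>C. max_over C f = f w \<and> (\<forall>x\<in>C. f x \<le> f w)"
proof -
  obtain w where w: "w \<in> C" "\<forall>x\<in>C. f x \<le> f w"
    using continuous_attains_sup[OF assms] by blast
  then have "max_over C f = f w"
    unfolding max_over_def by (intro Greatest_equality) auto
  with w show ?thesis by blast
qed

text \<open>The minimization problem with the given feasible set and objective.\<close>

datatype 'a problem = Minimize (feasible: "'a set") (objective: "'a \<Rightarrow> real")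

definition scale_objective :: "real \<Rightarrow> 'a problem \<Rightarrow> 'a problem" where
  "scale_objective c P = Minimize (feasible P) (\<lambda>u. c * objective P u)"

definition minmax_data :: "'a::euclidean_space set \<Rightarrow> 'b::euclidean_space set \<Rightarrow> ('a \<Rightarrow> 'b) \<Rightarrow> bool"
  where
  "minmax_data C1 C2 B \<longleftrightarrow>
     linear B \<and>
     C1 \<noteq> {} \<and> bounded C1 \<and> closed C1 \<and> convex C1 \<and>
     C2 \<noteq> {} \<and> bounded C2 \<and> closed C2 \<and> convex C2"

definition minmax_problem ::
    "'a::euclidean_space set \<Rightarrow> 'b::euclidean_space set \<Rightarrow> ('a \<Rightarrow> 'b) \<Rightarrow> 'a problem" where
  "minmax_problem C1 C2 B = Minimize C1 (\<lambda>u. max_over C2 (\<lambda>w. B u \<bullet> w))"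

definition nesterov_smoothing ::
    "real \<Rightarrow> 'a::euclidean_space set \<Rightarrow> 'b::euclidean_space set \<Rightarrow> ('a \<Rightarrow> 'b) \<Rightarrow> 'a problem" where
  "nesterov_smoothing \<mu> C1 C2 B =
     Minimize C1 (\<lambda>u. max_over C2 (\<lambda>w. B u \<bullet> w - \<mu> / 2 * (norm w)\<^sup>2))"

end

theory Submission
  imports Defs
begin

text \<open>
  Completing the square with \<open>x = B u / \<mu>\<close> turns the smoothed inner objective
  \<open>\<langle>B u, w\<rangle> - \<mu>/2 \<parallel>w\<parallel>\<^sup>2\<close> into \<open>\<mu>/2 (\<parallel>x\<parallel>\<^sup>2 - \<parallel>x - w\<parallel>\<^sup>2)\<close>, so maximizing it over \<open>w\<close> amounts to
  minimizing the distance from \<open>x\<close>; the maximizer is the projection of \<open>x\<close>.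
\<close>

lemma max_over_eqI:
  assumes "w \<in> C" "\<And>x. x \<in> C \<Longrightarrow> f x \<le> f w"
  shows "max_over C f = f w"
  unfolding max_over_def using assms by (intro Greatest_equality) auto

lemma min_over_eqI:
  assumes "w \<in> C" "\<And>x. x \<in> C \<Longrightarrow> f w \<le> f x"
  shows "min_over C f = f w"
  unfolding min_over_def using assms by (intro Least_equality) auto

text \<open>\<open>min_over\<close> and \<open>max_over\<close> are defined by \<open>LEAST\<close>
  and \<open>GREATEST\<close>, so negation carries one to the other only via an attained value.
  Compactness and continuity supply a minimizer of \<open>f\<close>, which is a maximizer of
  \<open>- f\<close>.\<close>

lemma uminus_min_over:
  fixes f :: "'a::topological_space \<Rightarrow> real"
  assumes "compact C" "C \<noteq> {}" "continuous_on C f"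
  shows "- min_over C f = max_over C (\<lambda>x. - f x)"
proof -
  obtain w where "w \<in> C" "\<forall>x\<in>C. f w \<le> f x"
    using continuous_attains_inf[OF assms] by blast
  then show ?thesis
    using min_over_eqI[of w C f] max_over_eqI[of w C "\<lambda>x. - f x"] by simp
qed

text \<open>Reduces the max-min problem, posed as minimization of the negated inner minimum, to the
  min-max form to which Nesterov smoothing applies.\<close>

lemma Minimize_uminus_min_over_eq_minmax_problem:
  assumes "compact C2" "C2 \<noteq> {}"
  shows "Minimize C1 (\<lambda>u. - min_over C2 (\<lambda>w. B u \<bullet> w)) = minmax_problem C1 C2 (\<lambda>u. - B u)"
proof -
  \<comment> \<open>The left side is the eta-contracted form that the inner objective of
    \<open>minmax_problem\<close> takes for \<open>- B u\<close>.\<close>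
  have "(\<bullet>) (- B u) = (\<lambda>w. - (B u \<bullet> w))" for u
    by auto
  then show ?thesis
    using uminus_min_over[OF assms, of "\<lambda>w. B u \<bullet> w" for u]
    by (simp add: minmax_problem_def continuous_intros)
qed

lemma max_over_inner_minus_square:
  fixes y :: "'a::euclidean_space"
  assumes "\<mu> > 0" "closed C" "C \<noteq> {}"
  defines "x \<equiv> (1 / \<mu>) *\<^sub>R y"
  shows "max_over C (\<lambda>w. y \<bullet> w - \<mu> / 2 * (norm w)\<^sup>2)
       = \<mu> / 2 * ((norm x)\<^sup>2 - (norm (x - closest_point C x))\<^sup>2)"
proof -
  have y: "y = \<mu> *\<^sub>R x"
    using \<open>\<mu> > 0\<close> by (simp add: x_def)
  have square: "y \<bullet> w - \<mu> / 2 * (norm w)\<^sup>2 = \<mu> / 2 * ((norm x)\<^sup>2 - (norm (x - w))\<^sup>2)" for w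
    unfolding y power2_norm_eq_inner by (simp add: algebra_simps inner_commute)
  show ?thesis
    unfolding square
  proof (rule max_over_eqI)
    \<comment> \<open>A nonempty closed set contains a point nearest to \<open>x\<close>, so the
      maximum is attained.\<close>
    show "closest_point C x \<in> C"
      using assms by (simp add: closest_point_in_set)
    show "\<mu> / 2 * ((norm x)\<^sup>2 - (norm (x - w))\<^sup>2)
        \<le> \<mu> / 2 * ((norm x)\<^sup>2 - (norm (x - closest_point C x))\<^sup>2)" if "w \<in> C" for w
      using closest_point_le[OF \<open>closed C\<close> that, of x] \<open>\<mu> > 0\<close>
      by (intro mult_left_mono diff_left_mono power_mono) (auto simp: dist_norm)
  qed
qed

lemma nesterov_smoothing_eq_scale_objective:
  fixes B :: "'a::euclidean_space \<Rightarrow> 'b::euclidean_space"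
  assumes "\<mu> > 0" "closed C2" "C2 \<noteq> {}"
  shows "nesterov_smoothing \<mu> C1 C2 B =
    scale_objective (\<mu> / 2)
      (Minimize C1 (\<lambda>u. (norm ((1 / \<mu>) *\<^sub>R B u))\<^sup>2
         - (norm ((1 / \<mu>) *\<^sub>R B u - closest_point C2 ((1 / \<mu>) *\<^sub>R B u)))\<^sup>2))"
  unfolding nesterov_smoothing_def scale_objective_def problem.sel
    max_over_inner_minus_square[OF assms] ..

text \<open>The norm of a vector is at most the sum of the norms of its components, so bounds for
  the factors add up. Components from any normed space are allowed, so that the lemma also covers
  vectors of vectors.\<close>

lemma bounded_vec_box:
  fixes C :: "'n::finite \<Rightarrow> 'a::real_normed_vector set"
  assumes "\<And>i. bounded (C i)"
  shows "bounded {x :: 'a ^ 'n. \<forall>i. x $ i \<in> C i}"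
proof -
  obtain r where r: "\<And>i y. y \<in> C i \<Longrightarrow> norm y \<le> r i"
    using assms unfolding bounded_iff by metis
  have "norm x \<le> (\<Sum>i\<in>UNIV. r i)" if "\<forall>i. x $ i \<in> C i" for x :: "'a ^ 'n"
  proof -
    have "norm x \<le> (\<Sum>i\<in>UNIV. norm (x $ i))"
      unfolding norm_vec_def by (rule L2_set_le_sum) simp
    also have "\<dots> \<le> (\<Sum>i\<in>UNIV. r i)"
      using that r by (intro sum_mono) auto
    finally show ?thesis .
  qed
  then show ?thesis
    unfolding bounded_iff by blast
qed

lemma closed_vec_box:
  fixes C :: "'n::finite \<Rightarrow> 'a::topological_space set"
  assumes "\<And>i. closed (C i)"
  shows "closed {x :: 'a ^ 'n. \<forall>i. x $ i \<in> C i}"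
  using assms closed_vimage_vec_nth by (auto simp: vimage_def intro!: closed_Collect_all)

lemma convex_vec_box:
  fixes C :: "'n::finite \<Rightarrow> 'a::real_vector set"
  assumes "\<And>i. convex (C i)"
  shows "convex {x :: 'a ^ 'n. \<forall>i. x $ i \<in> C i}"
  using assms unfolding convex_def by simp

text \<open>Both sets of the problem have this form: \<open>S\<close> with unit balls as factors,
  \<open>U\<close> with intervals.\<close>

lemma grid_box:
  fixes C :: "'n1::finite \<Rightarrow> 'n2::finite \<Rightarrow> 'k::finite \<Rightarrow> 'a::euclidean_space set"
  assumes "\<And>i j k. compact (C i j k)" "\<And>i j k. convex (C i j k)"
  shows "compact {x :: ('a, 'n1, 'n2, 'k) grid. \<forall>i j k. x $ i $ j $ k \<in> C i j k}" (is "compact ?S")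
    and "convex {x :: ('a, 'n1, 'n2, 'k) grid. \<forall>i j k. x $ i $ j $ k \<in> C i j k}"
proof -
  \<comment> \<open>A grid is a triply nested vector; written as a box of boxes of boxes, the set
    yields to one use of the box lemmas per level.\<close>
  have eq: "?S = {x. \<forall>i. x $ i \<in> {y. \<forall>j. y $ j \<in> {z. \<forall>k. z $ k \<in> C i j k}}}"
    by simp
  show "compact ?S"
    unfolding eq compact_eq_bounded_closed
    using assms by (intro conjI bounded_vec_box closed_vec_box)
      (auto simp: compact_imp_bounded compact_imp_closed)
  show "convex ?S"
    unfolding eq using assms by (intro convex_vec_box)
qed

theorem proposition2:
  fixes ulow uupp :: "(real, 'n1::{finite,linorder}, 'n2::{finite,linorder}, 'k::{finite,linorder}) grid"
    and t :: "nat \<Rightarrow> real" and b h1 h2 \<mu> :: real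
  assumes "CARD('n1) \<ge> 2" and "CARD('n2) \<ge> 2"
    and "h1 > 0" and "h2 > 0" and "b > 1"
    and "0 < t 1"
    and "\<forall>k\<in>{1..<CARD('k)}. t k < t (k + 1)"
    and "\<forall>k\<in>{1..<CARD('k)}. t (k + 1) = b * t k"
    and "\<forall>i j k. ulow $ i $ j $ k \<le> uupp $ i $ j $ k"
    and "\<mu> > 0"
  shows "let A = (grad_laplacian t b h1 h2 :: (real, 'n1, 'n2, 'k) grid \<Rightarrow> (real ^ 3, 'n1, 'n2, 'k) grid);
             S = pointwise_unit_balls;
             U = {u. \<forall>i j k. ulow $ i $ j $ k \<le> u $ i $ j $ k \<and> u $ i $ j $ k \<le> uupp $ i $ j $ k};
             B = (\<lambda>v. - adjoint A v)
         in Minimize S (\<lambda>v. - min_over U (\<lambda>w. adjoint A v \<bullet> w)) = minmax_problem S U B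
          \<and> minmax_data S U B
          \<and> nesterov_smoothing \<mu> S U B =
              scale_objective (\<mu> / 2)
                (Minimize S (\<lambda>v. (norm ((1 / \<mu>) *\<^sub>R adjoint A v))\<^sup>2
                   - (norm ((\<lambda>x. x - closest_point U x) (- ((1 / \<mu>) *\<^sub>R adjoint A v))))\<^sup>2))"
proof -
  define A where "A = (grad_laplacian t b h1 h2 :: (real, 'n1, 'n2, 'k) grid \<Rightarrow> (real ^ 3, 'n1, 'n2, 'k) grid)"
  define U where "U = {u. \<forall>i j k. ulow $ i $ j $ k \<le> u $ i $ j $ k \<and> u $ i $ j $ k \<le> uupp $ i $ j $ k}"
  define S where "S = (pointwise_unit_balls :: (real ^ 3, 'n1, 'n2, 'k) grid set)"
  have U_box: "U = {u. \<forall>i j k. u $ i $ j $ k \<in> {ulow $ i $ j $ k .. uupp $ i $ j $ k}}"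
    by (simp add: U_def)
  have S_box: "S = {v. \<forall>i j k. v $ i $ j $ k \<in> cball 0 1}"
    by (simp add: S_def pointwise_unit_balls_def)
  \<comment> \<open>The entrywise inequality between the bounds makes \<open>ulow\<close> a witness
    that \<open>U\<close> is nonempty.\<close>
  have "ulow \<in> U"
    using assms by (simp add: U_def)
  then have U: "compact U" "convex U" "U \<noteq> {}"
    using grid_box[of "\<lambda>i j k. {ulow $ i $ j $ k .. uupp $ i $ j $ k}"] U_box by auto
  have "0 \<in> S"
    by (simp add: S_box)
  then have "S \<noteq> {}"
    by blast
  with grid_box[of "\<lambda>_ _ _. cball 0 1"] have S: "compact S" "convex S" "S \<noteq> {}"
    unfolding S_box by simp_all
  have "linear (adjoint A)"
    unfolding A_def by (rule adjoint_linear[OF linear_grad_laplacian])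
  then have "minmax_data S U (\<lambda>v. - adjoint A v)"
    using S U by (auto simp: minmax_data_def compact_eq_bounded_closed intro: linear_compose_neg)
  moreover have "Minimize S (\<lambda>v. - min_over U (\<lambda>w. adjoint A v \<bullet> w))
      = minmax_problem S U (\<lambda>v. - adjoint A v)"
    using U by (intro Minimize_uminus_min_over_eq_minmax_problem)
  \<comment> \<open>Here \<open>B v / \<mu>\<close> is
    \<open>- ((1 / \<mu>) *\<^sub>R adjoint A v)\<close>. Its sign disappears from the first norm
    but stays in the argument of the projection.\<close>
  moreover have "nesterov_smoothing \<mu> S U (\<lambda>v. - adjoint A v) =
      scale_objective (\<mu> / 2)
        (Minimize S (\<lambda>v. (norm ((1 / \<mu>) *\<^sub>R adjoint A v))\<^sup>2
           - (norm (- ((1 / \<mu>) *\<^sub>R adjoint A v) - closest_point U (- ((1 / \<mu>) *\<^sub>R adjoint A v))))\<^sup>2))"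
    using nesterov_smoothing_eq_scale_objective[of \<mu> U S "\<lambda>v. - adjoint A v"] \<open>\<mu> > 0\<close> U
    by (simp add: compact_imp_closed)
  ultimately show ?thesis
    unfolding Let_def A_def S_def U_def by (intro conjI)
qed

end
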